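(* Let $U$ be a non-empty finite set and let $R\subseteq U\times U$ be a tolerance relation (reflexive and symmetric) or an equivalence relation on $U$. Then for all $X\subseteq U$, $$\underline{apr}_{s}(X)=\underline{apr}_{p}(X)=\underline{apr}_{p\wedge s}(X)=\underline{apr}_{p\vee s}(X)\subseteq X\subseteq\overline{apr}_{s}(X)=\overline{apr}_{p}(X)=\overline{apr}_{p\wedge s}(X)=\overline{apr}_{p\vee s}(X).$$
   Context: For $x\in U$ put $R_s(x)=\{y\in U\mid (x,y)\in R\}$, $R_p(x)=\{y\in U\mid (y,x)\in R\}$, $R_{p\wedge s}(x)=R_s(x)\cap R_p(x)$, $R_{p\vee s}(x)=R_s(x)\cup R_p(x)$. For $i\in\{s,p,p\wedge s,p\vee s\}$ and $X\subseteq U$, $\underline{apr}_i(X)=\{x\in U\mid R_i(x)\subseteq X\}$ and $\overline{apr}_i(X)=\{x\in U\mid R_i(x)\cap X\neq\emptyset\}$. *)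

theory Defs
  imports Main
begin

definition tolerance_on :: "'a set \<Rightarrow> 'a rel \<Rightarrow> bool" where
  "tolerance_on U R \<longleftrightarrow> R \<subseteq> U \<times> U \<and> refl_on U R \<and> sym R"

definition succ_nbhd :: "'a set \<Rightarrow> 'a rel \<Rightarrow> 'a \<Rightarrow> 'a set" where
  "succ_nbhd U R x = {y \<in> U. (x, y) \<in> R}"

definition pred_nbhd :: "'a set \<Rightarrow> 'a rel \<Rightarrow> 'a \<Rightarrow> 'a set" where
  "pred_nbhd U R x = {y \<in> U. (y, x) \<in> R}"

datatype nbhd_kind = Succ | Pred | PredAndSucc | PredOrSucc

fun nbhd :: "nbhd_kind \<Rightarrow> 'a set \<Rightarrow> 'a rel \<Rightarrow> 'a \<Rightarrow> 'a set" where
  "nbhd Succ U R x = succ_nbhd U R x"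
| "nbhd Pred U R x = pred_nbhd U R x"
| "nbhd PredAndSucc U R x = succ_nbhd U R x \<inter> pred_nbhd U R x"
| "nbhd PredOrSucc U R x = succ_nbhd U R x \<union> pred_nbhd U R x"

definition lower_apr :: "nbhd_kind \<Rightarrow> 'a set \<Rightarrow> 'a rel \<Rightarrow> 'a set \<Rightarrow> 'a set" where
  "lower_apr i U R X = {x \<in> U. nbhd i U R x \<subseteq> X}"

definition upper_apr :: "nbhd_kind \<Rightarrow> 'a set \<Rightarrow> 'a rel \<Rightarrow> 'a set \<Rightarrow> 'a set" where
  "upper_apr i U R X = {x \<in> U. nbhd i U R x \<inter> X \<noteq> {}}"

end

theory Submission
  imports Defs
begin

text \<open>Symmetry makes successors and predecessors coincide, so their intersection and union add
  nothing new: all four neighbourhoods are one set (\<open>nbhd_eq_succ_nbhd\<close>), and the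
  approximations, which see the relation only through it, agree. Reflexivity puts each point of
  \<open>U\<close> in its own neighbourhood, which yields both inclusions.\<close>

lemma nbhd_eq_succ_nbhd:
  assumes "sym R"
  shows "nbhd i U R x = succ_nbhd U R x"
proof -
  have "pred_nbhd U R x = succ_nbhd U R x"
    using assms by (auto simp: pred_nbhd_def succ_nbhd_def dest: symD)
  then show ?thesis
    by (cases i) simp_all
qed

lemma lower_apr_subset:
  assumes "refl_on U R" "sym R"
  shows "lower_apr i U R X \<subseteq> X"
  using assms by (auto simp: lower_apr_def nbhd_eq_succ_nbhd succ_nbhd_def dest: refl_onD)

text \<open>A point of \<open>X\<close> is itself a common element of its neighbourhood and
  \<open>X\<close>; \<open>X \<subseteq> U\<close> lets reflexivity apply to it.\<close>

lemma subset_upper_apr: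
  assumes "refl_on U R" "sym R" "X \<subseteq> U"
  shows "X \<subseteq> upper_apr i U R X"
  using assms by (auto simp: upper_apr_def nbhd_eq_succ_nbhd succ_nbhd_def dest: refl_onD)

theorem proposition30:
  fixes U :: "'a set" and R :: "'a rel"
  assumes "finite U" and "U \<noteq> {}"
    and "R \<subseteq> U \<times> U"
    and "tolerance_on U R \<or> equiv U R"
  shows "\<forall>X. X \<subseteq> U \<longrightarrow>
      lower_apr Succ U R X = lower_apr Pred U R X
    \<and> lower_apr Pred U R X = lower_apr PredAndSucc U R X
    \<and> lower_apr PredAndSucc U R X = lower_apr PredOrSucc U R X
    \<and> lower_apr PredOrSucc U R X \<subseteq> X
    \<and> X \<subseteq> upper_apr Succ U R X
    \<and> upper_apr Succ U R X = upper_apr Pred U R X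
    \<and> upper_apr Pred U R X = upper_apr PredAndSucc U R X
    \<and> upper_apr PredAndSucc U R X = upper_apr PredOrSucc U R X"
proof -
  \<comment> \<open>Both alternatives of the hypothesis are used only through what they
    share.\<close>
  have R: "refl_on U R" "sym R"
    using assms(4) by (auto simp: tolerance_on_def equiv_def)
  \<comment> \<open>With \<open>i\<close> and \<open>j\<close> arbitrary, every equality in the two
    chains is an instance.\<close>
  have "lower_apr i U R X = lower_apr j U R X" "upper_apr i U R X = upper_apr j U R X" for i j X
    by (simp_all add: lower_apr_def upper_apr_def nbhd_eq_succ_nbhd[OF R(2)])
  then show ?thesis
    using lower_apr_subset[OF R] subset_upper_apr[OF R] by blast
qed

end
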